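(* Let $p$ be a prime, let $G=UT(4,p)$, and let $$\mathcal L_0^*=\{(a,b,c,0,e,f):(a,f)\in \mathbb F_p^2\setminus\{(0,0)\},\ b,c,e\in\mathbb F_p\}\subset G.$$ Then $\alpha\bigl(\Gamma[\mathcal L_0^*]\bigr)\ge 3p-2$.
   Context: For a prime $p$, $UT(4,p)$ is the group, under matrix multiplication, of all $4\times 4$ upper triangular matrices over $\mathbb{F}_p$ with all diagonal entries equal to $1$. The $6$-tuple $(a,b,c,d,e,f)\in\mathbb{F}_p^6$ denotes the matrix $\begin{pmatrix}1&a&b&c\\0&1&d&e\\0&0&1&f\\0&0&0&1\end{pmatrix}$. The commuting graph $\Gamma(G)$ has vertex set $G$, two distinct vertices $x,y$ being adjacent if and only if $xy=yx$. For a subset $S\subseteq G$, $\Gamma[S]$ denotes the subgraph of $\Gamma(G)$ induced on $S$. The independence number $\alpha$ of a graph is the maximum size of a set of pairwise nonadjacent vertices. *)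

theory Defs
  imports
    "HOL-Algebra.Group"
    "Jordan_Normal_Form.Matrix"
    "Berlekamp_Zassenhaus.Finite_Field"
    "Graph_Theory.Graph_Theory"
begin

section \<open>Unitriangular groups\<close>

definition UT :: "nat \<Rightarrow> 'f::field mat monoid" where
  "UT n = \<lparr>carrier = {A \<in> carrier_mat n n. upper_triangular A \<and> (\<forall>i<n. A $$ (i, i) = 1)},
           mult = (*), one = 1\<^sub>m n\<rparr>"

definition ut4 :: "'f \<Rightarrow> 'f \<Rightarrow> 'f \<Rightarrow> 'f \<Rightarrow> 'f \<Rightarrow> 'f \<Rightarrow> 'f::field mat" where
  "ut4 a b c d e f = mat_of_rows_list 4
     [[1, a, b, c],
      [0, 1, d, e],
      [0, 0, 1, f],
      [0, 0, 0, 1]]"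

definition L0_star :: "'f::field mat set" where
  "L0_star = {ut4 a b c 0 e f | a b c e f. (a, f) \<noteq> (0, 0)}"

section \<open>Commuting graphs and independence number\<close>

text \<open>A simple graph is encoded as a loop-free symmetric digraph: an edge is a pair of opposite
  arcs.\<close>

definition commuting_graph :: "('g, 'm) monoid_scheme \<Rightarrow> ('g, 'g \<times> 'g) pre_digraph" where
  "commuting_graph G = with_proj
     \<lparr>pverts = carrier G,
      parcs = {(x, y). x \<in> carrier G \<and> y \<in> carrier G \<and> x \<noteq> y \<and> x \<otimes>\<^bsub>G\<^esub> y = y \<otimes>\<^bsub>G\<^esub> x}\<rparr>"

definition independent_set :: "('v, 'e) pre_digraph \<Rightarrow> 'v set \<Rightarrow> bool" where
  "independent_set X S \<longleftrightarrow>
     S \<subseteq> verts X \<and> (\<forall>x\<in>S. \<forall>y\<in>S. x \<noteq> y \<longrightarrow> (x, y) \<notin> arcs_ends X)"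

text \<open>Meaningful only for graphs with finitely many vertices.\<close>

definition independence_number :: "('v, 'e) pre_digraph \<Rightarrow> nat" where
  "independence_number X = Max (card ` {S. independent_set X S})"

section \<open>Basic facts\<close>

lemma set_upt_4: "{0..<4} = {0, 1, 2, 3::nat}"
  by auto

lemma less_4_iff: "(i::nat) < 4 \<longleftrightarrow> i = 0 \<or> i = 1 \<or> i = 2 \<or> i = 3"
  by auto

lemma less_less_4:
  assumes "j < i" "i < (4::nat)"
  obtains "i = 1" "j = 0" | "i = 2" "j = 0" | "i = 2" "j = 1"
    | "i = 3" "j = 0" | "i = 3" "j = 1" | "i = 3" "j = 2"
  using assms by linarith

lemma dim_ut4 [simp]: "dim_row (ut4 a b c d e f) = 4" "dim_col (ut4 a b c d e f) = 4"
  by (simp_all add: ut4_def mat_of_rows_list_def)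

lemma ut4_index:
  assumes "i < 4" "j < 4"
  shows "ut4 a b c d e f $$ (i, j) =
    [[1, a, b, c], [0, 1, d, e], [0, 0, 1, f], [0, 0, 0, 1]] ! i ! j"
  using assms unfolding ut4_def mat_of_rows_list_def by (subst index_mat) auto

lemma ut4_in_carrier: "ut4 a b c d e f \<in> carrier (UT 4)"
proof -
  have "ut4 a b c d e f $$ (i, j) = 0" if "j < i" "i < 4" for i j
    using that by (cases rule: less_less_4) (simp_all add: ut4_index)
  moreover have "ut4 a b c d e f $$ (i, i) = 1" if "i < 4" for i
    using that by (subst ut4_index) (auto dest!: less_4_iff[THEN iffD1])
  ultimately show ?thesis
    by (auto simp: UT_def upper_triangular_def)
qed

lemma carrier_UT4: "carrier (UT 4) = {ut4 a b c d e f | a b c d e f. True}"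
proof (intro equalityI subsetI)
  fix A :: "'a mat" assume "A \<in> carrier (UT 4)"
  then have A: "A \<in> carrier_mat 4 4" "upper_triangular A" "\<forall>i<4. A $$ (i, i) = 1"
    by (auto simp: UT_def)
  have low: "A $$ (i, j) = 0" if "j < i" "i < 4" for i j
    using A that by auto
  have "A = ut4 (A $$ (0,1)) (A $$ (0,2)) (A $$ (0,3)) (A $$ (1,2)) (A $$ (1,3)) (A $$ (2,3))"
  proof (rule eq_matI)
    fix i j
    assume "i < dim_row (ut4 (A $$ (0,1)) (A $$ (0,2)) (A $$ (0,3)) (A $$ (1,2)) (A $$ (1,3))
        (A $$ (2,3)))"
      "j < dim_col (ut4 (A $$ (0,1)) (A $$ (0,2)) (A $$ (0,3)) (A $$ (1,2)) (A $$ (1,3))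
        (A $$ (2,3)))"
    then have ij: "i < 4" "j < 4" by simp_all
    show "A $$ (i, j) = ut4 (A $$ (0,1)) (A $$ (0,2)) (A $$ (0,3)) (A $$ (1,2)) (A $$ (1,3))
        (A $$ (2,3)) $$ (i, j)"
    proof (cases i j rule: linorder_cases)
      case less
      then show ?thesis
        using ij(2) by (cases rule: less_less_4) (simp_all add: ut4_index)
    next
      case equal
      then show ?thesis
        using ij A(3) by (auto simp: ut4_index dest!: less_4_iff[THEN iffD1])
    next
      case greater
      then have "A $$ (i, j) = 0"
        using ij low by blast
      show ?thesis
        using greater ij(1) \<open>A $$ (i, j) = 0\<close>
        by (cases rule: less_less_4) (simp_all add: ut4_index)
    qed
  qed (use A(1) in auto)
  then show "A \<in> {ut4 a b c d e f | a b c d e f. True}"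
    by blast
qed (use ut4_in_carrier in auto)

lemma ut4_mult:
  "ut4 a b c d e f * ut4 a' b' c' d' e' f' =
   ut4 (a + a') (b + a * d' + b') (c + a * e' + b * f' + c') (d + d') (e + d * f' + e') (f + f')"
  (is "?A * ?B = ?C")
proof (rule eq_matI)
  fix i j
  assume "i < dim_row ?C" "j < dim_col ?C"
  then have ij: "i < 4" "j < 4" by simp_all
  then have "(?A * ?B) $$ (i, j) = (\<Sum>k\<in>{0, 1, 2, 3}. ?A $$ (i, k) * ?B $$ (k, j))"
    by (simp add: scalar_prod_def set_upt_4)
  also have "\<dots> = ?A $$ (i, 0) * ?B $$ (0, j) + ?A $$ (i, 1) * ?B $$ (1, j) +
      ?A $$ (i, 2) * ?B $$ (2, j) + ?A $$ (i, 3) * ?B $$ (3, j)"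
    by simp
  also have "\<dots> = ?C $$ (i, j)"
    using ij by (auto simp: ut4_index algebra_simps dest!: less_4_iff[THEN iffD1])
  finally show "(?A * ?B) $$ (i, j) = ?C $$ (i, j)" .
qed simp_all

lemma ut4_one: "ut4 0 0 0 0 0 0 = 1\<^sub>m 4"
  by (rule eq_matI) (auto simp: ut4_index dest!: less_4_iff[THEN iffD1])

lemma group_UT4: "group (UT 4)"
proof (rule groupI)
  fix x y :: "'a mat" assume "x \<in> carrier (UT 4)" "y \<in> carrier (UT 4)"
  then show "x \<otimes>\<^bsub>UT 4\<^esub> y \<in> carrier (UT 4)"
    using ut4_in_carrier unfolding carrier_UT4 by (auto simp: UT_def ut4_mult carrier_UT4) blast
next
  show "\<one>\<^bsub>UT 4\<^esub> \<in> carrier (UT 4 :: 'a mat monoid)"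
    using ut4_in_carrier[of 0 0 0 0 0 0] by (simp add: ut4_one UT_def)
next
  fix x y z :: "'a mat"
  assume "x \<in> carrier (UT 4)" "y \<in> carrier (UT 4)" "z \<in> carrier (UT 4)"
  then show "x \<otimes>\<^bsub>UT 4\<^esub> y \<otimes>\<^bsub>UT 4\<^esub> z = x \<otimes>\<^bsub>UT 4\<^esub> (y \<otimes>\<^bsub>UT 4\<^esub> z)"
    by (auto simp: UT_def)
next
  fix x :: "'a mat" assume "x \<in> carrier (UT 4)"
  then show "\<one>\<^bsub>UT 4\<^esub> \<otimes>\<^bsub>UT 4\<^esub> x = x"
    by (auto simp: UT_def)
next
  fix x :: "'a mat" assume "x \<in> carrier (UT 4)"
  then obtain a b c d e f where x: "x = ut4 a b c d e f"
    unfolding carrier_UT4 by auto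
  let ?y = "ut4 (- a) (a * d - b) (a * e + b * f - c - a * d * f) (- d) (d * f - e) (- f)"
  have "?y * x = 1\<^sub>m 4"
    unfolding x ut4_mult ut4_one[symmetric] by (simp add: algebra_simps)
  then show "\<exists>y\<in>carrier (UT 4). y \<otimes>\<^bsub>UT 4\<^esub> x = \<one>\<^bsub>UT 4\<^esub>"
    by (intro bexI[OF _ ut4_in_carrier]) (simp add: UT_def)
qed

lemma L0_star_subset: "L0_star \<subseteq> carrier (UT 4)"
  using ut4_in_carrier by (auto simp: L0_star_def)

lemma verts_commuting_graph: "verts (commuting_graph G) = carrier G"
  by (simp add: commuting_graph_def)

lemma adj_induce_commuting_graph:
  assumes "S \<subseteq> carrier G"
  shows "(x, y) \<in> arcs_ends (induce_subgraph (commuting_graph G) S) \<longleftrightarrow>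
     x \<in> S \<and> y \<in> S \<and> x \<noteq> y \<and> x \<otimes>\<^bsub>G\<^esub> y = y \<otimes>\<^bsub>G\<^esub> x"
  using assms by (auto simp: commuting_graph_def arcs_ends_def arc_to_ends_def induce_subgraph_def)

lemma independence_number_ge:
  assumes "finite (verts X)" "independent_set X S"
  shows "card S \<le> independence_number X"
proof -
  have "{S. independent_set X S} \<subseteq> Pow (verts X)"
    by (auto simp: independent_set_def)
  then have "finite {S. independent_set X S}"
    using assms(1) by (meson finite_Pow_iff finite_subset)
  then show ?thesis
    unfolding independence_number_def using assms(2) by (intro Max_ge) auto
qed

lemma finite_L0_star: "finite (L0_star :: 'f::{field,finite} mat set)"
proof -
  have "L0_star \<subseteq> (\<lambda>(a, b, c, e, f). ut4 a b c 0 e f) ` (UNIV :: ('f \<times> 'f \<times> 'f \<times> 'f \<times> 'f) set)"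
    by (force simp: L0_star_def image_iff)
  then show ?thesis
    by (rule finite_subset) simp
qed

end

theory Submission
  imports Defs
begin

text \<open>
  Matrices with \<open>d = 0\<close> multiply like elements of a Heisenberg group: two of them commute exactly
  if the symplectic form \<open>\<omega> = a e' + b f' - a' e - b' f\<close> vanishes on their
  coordinates. So the question is how many vectors of a four-dimensional symplectic space,
  none of them in the Lagrangian plane \<open>a = f = 0\<close>, can be pairwise non-orthogonal.

  Write a vector as \<open>(u, v)\<close> with \<open>u = (a, f)\<close>, \<open>v = (e, -b)\<close>; then \<open>\<omega> = u \<bullet> v' - u' \<bullet> v\<close>,
  and the vectors to avoid are those with \<open>u = 0\<close>. The torus \<open>(u, v) \<mapsto> (u, t v)\<close>
  scales \<open>\<omega>\<close>, so between \<open>(u\<^sub>i, s v\<^sub>i)\<close> and \<open>(u\<^sub>j, t v\<^sub>j)\<close> the form is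
  \<open>t (u\<^sub>i \<bullet> v\<^sub>j) - s (u\<^sub>j \<bullet> v\<^sub>i)\<close>. Two points of one orbit are thus non-orthogonal as soon as
  \<open>u\<^sub>i \<bullet> v\<^sub>i \<noteq> 0\<close>, and two different orbits are completely non-orthogonal if exactly one of
  \<open>u\<^sub>i \<bullet> v\<^sub>j\<close> and \<open>u\<^sub>j \<bullet> v\<^sub>i\<close> is zero. Three orbits can be arranged cyclically, with
  \<open>v\<^sub>1 \<bottom> u\<^sub>2\<close>, \<open>v\<^sub>2 \<bottom> u\<^sub>3\<close>, \<open>v\<^sub>3 \<bottom> u\<^sub>1\<close> and \<open>u\<^sub>1, u\<^sub>2, u\<^sub>3\<close> pairwise independent, so that
  no other product \<open>u\<^sub>i \<bullet> v\<^sub>j\<close> vanishes. They have \<open>3 (p - 1)\<close> points.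
  A fixed point \<open>(u, 0)\<close> is non-orthogonal to all of them if \<open>u\<close> is not proportional to any \<open>u\<^sub>i\<close>. Such a \<open>u\<close> exists if the projective line has a fourth point,
  that is, for \<open>p > 2\<close>, and the total is \<open>3 p - 2\<close>.

  For \<open>p = 2\<close> the bound is \<open>4 = 2 p\<close>, and it is reached by \<open>p\<close> points on each of two hyperbolic
  lines.
\<close>

lemma ut4_commute_iff:
  "ut4 a b c 0 e f * ut4 a' b' c' 0 e' f' = ut4 a' b' c' 0 e' f' * ut4 a b c 0 e f \<longleftrightarrow>
     a * e' + b * f' = a' * e + b' * f" (is "?A * ?B = ?B * ?A \<longleftrightarrow> _")
proof
  assume "?A * ?B = ?B * ?A"
  then have "(?A * ?B) $$ (0, 3) = (?B * ?A) $$ (0, 3)" by simp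
  then show "a * e' + b * f' = a' * e + b' * f"
    by (simp add: ut4_mult ut4_index algebra_simps)
next
  assume eq: "a * e' + b * f' = a' * e + b' * f"
  have "c + (a * e' + b * f') + c' = c' + (a' * e + b' * f) + c"
    unfolding eq by (simp add: ac_simps)
  then show "?A * ?B = ?B * ?A"
    unfolding ut4_mult by (simp add: ac_simps)
qed

text \<open>Distinctness of the points needs no separate check, since every vector is
  orthogonal to itself. The corner entry is central and may be taken to be zero.\<close>

lemma independence_number_L0_star_ge:
  fixes a b e f :: "'i \<Rightarrow> 'f::{field,finite}"
  assumes outside: "\<And>i. i \<in> I \<Longrightarrow> (a i, f i) \<noteq> (0, 0)"
    and nonorth: "\<And>i j. i \<in> I \<Longrightarrow> j \<in> I \<Longrightarrow> i \<noteq> j \<Longrightarrow>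
      a i * e j + b i * f j \<noteq> a j * e i + b j * f i"
  shows "card I \<le> independence_number
    (induce_subgraph (commuting_graph (UT 4 :: 'f mat monoid)) L0_star)"
proof -
  let ?X = "induce_subgraph (commuting_graph (UT 4 :: 'f mat monoid)) L0_star"
  let ?M = "\<lambda>i. ut4 (a i) (b i) 0 0 (e i) (f i)"
  have noncommuting: "?M i * ?M j \<noteq> ?M j * ?M i" if "i \<in> I" "j \<in> I" "i \<noteq> j" for i j
    using nonorth[OF that] by (simp add: ut4_commute_iff)
  then have inj: "inj_on ?M I"
    by (metis (mono_tags, lifting) inj_onI)
  have sub: "?M ` I \<subseteq> L0_star"
    using outside by (fastforce simp: L0_star_def)
  have "independent_set ?X (?M ` I)"
    unfolding independent_set_def adj_induce_commuting_graph[OF L0_star_subset]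
    using sub noncommuting by (auto simp: UT_def)
  then have "card (?M ` I) \<le> independence_number ?X"
    by (intro independence_number_ge) (simp_all add: finite_L0_star)
  then show ?thesis
    by (simp add: card_image[OF inj])
qed

text \<open>One hyperbolic line is spanned by the \<open>a\<close> and \<open>e\<close> directions. The other is the span of
  the \<open>b\<close> direction and the sum of the \<open>e\<close> and \<open>f\<close> directions; its \<open>e\<close> component gives the form
  the constant value 1 between a point of the first family and one of the second.\<close>

lemma independence_number_L0_star_ge_twice:
  "2 * CARD('f::{field,finite}) \<le> independence_number
     (induce_subgraph (commuting_graph (UT 4 :: 'f mat monoid)) L0_star)"
proof -
  let ?I = "(UNIV :: bool set) \<times> (UNIV :: 'f set)"
  have "card ?I \<le> independence_number
      (induce_subgraph (commuting_graph (UT 4 :: 'f mat monoid)) L0_star)"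
    by (rule independence_number_L0_star_ge
        [where a = "\<lambda>(k, t). if k then 1 else 0" and b = "\<lambda>(k, t). if k then 0 else t"
          and e = "\<lambda>(k, t). if k then t else 1" and f = "\<lambda>(k, t). if k then 0 else 1"])
      (auto split: if_splits)
  then show ?thesis
    by (simp add: card_cartesian_product)
qed

text \<open>The orbits use \<open>u\<^sub>1 = (1, 0)\<close>, \<open>u\<^sub>2 = (0, 1)\<close>, \<open>u\<^sub>3 = (1, 1)\<close> with
  \<open>v\<^sub>1 = (1, 0)\<close>, \<open>v\<^sub>2 = (1, -1)\<close>, \<open>v\<^sub>3 = (0, -1)\<close>. The fixed point has
  \<open>u = (1, -1)\<close>, which is proportional to \<open>u\<^sub>3\<close> exactly in characteristic 2.\<close>

lemma independence_number_L0_star_ge_thrice: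
  assumes two: "(2 :: 'f::{field,finite}) \<noteq> 0"
  shows "3 * CARD('f) - 2 \<le> independence_number
     (induce_subgraph (commuting_graph (UT 4 :: 'f mat monoid)) L0_star)"
proof -
  \<comment> \<open>The first component numbers the orbits; 3 stands for the fixed point.\<close>
  let ?J = "{0, 1, 2 :: nat} \<times> (UNIV - {0 :: 'f})"
  let ?I = "insert (3, 0) ?J"
  have "card ?I \<le> independence_number
      (induce_subgraph (commuting_graph (UT 4 :: 'f mat monoid)) L0_star)"
    by (rule independence_number_L0_star_ge
        [where a = "\<lambda>(k, t). [1, 0, 1, 1] ! k" and b = "\<lambda>(k, t). [0, t, t, 0] ! k"
          and e = "\<lambda>(k, t). [t, t, 0, 0] ! k" and f = "\<lambda>(k, t). [0, 1, 1, -1] ! k"])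
      (auto simp: eq_neg_iff_add_eq_0 neg_eq_iff_add_eq_0 mult_2[symmetric] two)
  moreover have "card ?I = card ?J + 1"
    by simp
  moreover have "card ?J = 3 * (CARD('f) - 1)"
    by (simp only: card_cartesian_product card_Diff_singleton[OF UNIV_I]) simp
  moreover have "CARD('f) \<ge> 1"
    by (simp add: Suc_leI)
  ultimately show ?thesis
    by linarith
qed

theorem proposition6p7:
  fixes p :: nat
  assumes "prime p" and "CARD('p::prime_card) = p"
  shows "independence_number
           (induce_subgraph (commuting_graph (UT 4 :: 'p mod_ring mat monoid)) L0_star)
         \<ge> 3 * p - 2"
proof (cases "p = 2")
  case True
  then show ?thesis
    using independence_number_L0_star_ge_twice[where 'f = "'p mod_ring"] assms(2) by simp
next
  case False
  then have "\<not> p dvd 2"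
    using assms(1) two_is_prime_nat primes_dvd_imp_eq by blast
  then have "of_nat 2 \<noteq> (0 :: 'p mod_ring)"
    using assms(2) by (metis of_nat_0_mod_ring_dvd)
  then show ?thesis
    using independence_number_L0_star_ge_thrice[where 'f = "'p mod_ring"] assms(2) by simp
qed

end
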